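(* Let $s,n,N$ be positive integers and let $j\in\mathbb{Z}_N$ (represented by an integer with $0\le j<N$). Then $$M_{s,n,N}(j)=\sum_{\substack{0\le i\le N_{s,n}\\ i\equiv j\ (\mathrm{mod}\ N)}}[q^i]\,T_{s,n}(q)=\frac1N\sum_{\substack{\psi\in\hat{\mathbb{Z}}_N\\ \psi\ne\psi_0}}\psi^{-1}(j)\prod_{a\in D_n}\bigl(1-\psi(-a)\bigr)^s .$$
   Context: $T_{s,n}(q)=\prod_{k=1}^n(1-q^k)^s$ is a polynomial of degree $N_{s,n}=sn(n+1)/2$, and $[q^i]T_{s,n}(q)$ denotes its coefficient of $q^i$. $D_n=\{1,2,\dots,n\}$. $\mathbb{Z}_N$ is the cyclic group of integers modulo $N$ (written additively), $\hat{\mathbb{Z}}_N$ is the set of its complex-valued linear characters, $\psi_0$ is the trivial character, $\psi^{-1}$ is the inverse character of $\psi$, and $\psi(m)$ for an integer $m$ means $\psi$ evaluated at the residue class of $m$. $M_{s,n,N}(j)$ is defined as the signed count $$M_{s,n,N}(j)=\sum_{0\le k_1,\dots,k_s\le n}(-1)^{k_1+\cdots+k_s}M_{s,n,N}(k_1,\dots,k_s,j),$$ where $M_{s,n,N}(k_1,\dots,k_s,j)$ is the number of $s$-tuples $(V_1,\dots,V_s)$ of subsets of $D_n$ with $|V_i|=k_i$ for all $i$ and $\sum_{i=1}^s\sum_{x\in V_i}x\equiv j\pmod N$.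
   Formalization: The product is taken over 1 − ψ(a) instead of the printed 1 − ψ(−a): the printed formula gives the count at −j and is false, e.g. for s = n = 1, N = 3, j = 1 the count is −1 but the printed sum is 0. *)

theory Defs
  imports
    Complex_Main
    "HOL-Library.FuncSet"
    "HOL-Computational_Algebra.Polynomial"
    "HOL-Number_Theory.Cong"
    "HOL-Algebra.Elementary_Groups"
begin

definition T_poly :: "nat \<Rightarrow> nat \<Rightarrow> int poly" where
  "T_poly s n = (\<Prod>k = 1..n. (1 - monom 1 k) ^ s)"

definition N_deg :: "nat \<Rightarrow> nat \<Rightarrow> nat" where
  "N_deg s n = s * n * (n + 1) div 2"

definition D_set :: "nat \<Rightarrow> nat set" where
  "D_set n = {1..n}"

(* s-tuples are extensional functions on {1..s}, so that the sets of tuples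
   that are counted or summed over are finite. *)

definition M_count :: "nat \<Rightarrow> nat \<Rightarrow> nat \<Rightarrow> (nat \<Rightarrow> nat) \<Rightarrow> int \<Rightarrow> nat" where
  "M_count s n N k j =
     card {V \<in> {1..s} \<rightarrow>\<^sub>E Pow (D_set n).
             (\<forall>i \<in> {1..s}. card (V i) = k i) \<and>
             [(\<Sum>i = 1..s. \<Sum>x \<in> V i. int x) = j] (mod (int N))}"

definition M_signed :: "nat \<Rightarrow> nat \<Rightarrow> nat \<Rightarrow> int \<Rightarrow> int" where
  "M_signed s n N j =
     (\<Sum>k \<in> {1..s} \<rightarrow>\<^sub>E {0..n}. (-1) ^ (\<Sum>i = 1..s. k i) * int (M_count s n N k j))"

definition complex_mult_group :: "complex monoid" where
  "complex_mult_group = \<lparr>carrier = - {0}, mult = (*), one = 1\<rparr>"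

(* For N > 0 the group "integer_mod_group N" has carrier {0..<int N}. Characters are
   taken extensional, so each character of Z_N is represented by exactly one function. *)

definition ZN_dual :: "nat \<Rightarrow> (int \<Rightarrow> complex) set" where
  "ZN_dual N =
     hom (integer_mod_group N) complex_mult_group \<inter> extensional (carrier (integer_mod_group N))"

definition trivial_char :: "nat \<Rightarrow> int \<Rightarrow> complex" where
  "trivial_char N = (\<lambda>x \<in> carrier (integer_mod_group N). 1)"

definition inverse_char :: "nat \<Rightarrow> (int \<Rightarrow> complex) \<Rightarrow> int \<Rightarrow> complex" where
  "inverse_char N \<psi> = (\<lambda>x \<in> carrier (integer_mod_group N). inverse (\<psi> x))"

definition char_at :: "nat \<Rightarrow> (int \<Rightarrow> complex) \<Rightarrow> int \<Rightarrow> complex" where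
  "char_at N \<psi> m = \<psi> (m mod int N)"

(* Sign convention for the character formula. By orthogonality, with the factor
   \<psi>^{-1}(j) in front, the product has to be over 1 - \<psi>(a). The variant with
   1 - \<psi>(-a) has the value of the signed count at -j, which in general differs from the
   one at j: for s = n = 1, N = 3, j = 1 the count is -1, the variant gives 0. *)

end

theory Submission
  imports Defs
begin

text \<open>
  Expanding the product over k of (1 - y^k)^s over s-tuples V of subsets of D_n gives, in any
  commutative ring, the sum of the terms (-1)^(card V_1 + ... + card V_s) y^(total sum of V).
  Taking y = q and collecting coefficients yields the first identity. The characters of Z_N
  correspond to the N-th roots of unity z; taking y = z and applying orthogonality yields the
  second, where the trivial character contributes 0 because its product contains the
  factor 1 - 1.
\<close>

section \<open>Expansion of the product over tuples of subsets\<close>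

definition subset_tuples :: "nat \<Rightarrow> nat \<Rightarrow> (nat \<Rightarrow> nat set) set" where
  "subset_tuples s n = {1..s} \<rightarrow>\<^sub>E Pow (D_set n)"

text \<open>Polymorphic because the same sign occurs among integers, integer polynomials and complex
  numbers.\<close>

definition tuple_sign :: "nat \<Rightarrow> (nat \<Rightarrow> nat set) \<Rightarrow> 'a :: comm_ring_1" where
  "tuple_sign s V = (-1) ^ (\<Sum>i = 1..s. card (V i))"

definition tuple_sum :: "nat \<Rightarrow> (nat \<Rightarrow> nat set) \<Rightarrow> nat" where
  "tuple_sum s V = (\<Sum>i = 1..s. \<Sum>x \<in> V i. x)"

lemma finite_subset_tuples [simp]: "finite (subset_tuples s n)"
  by (auto simp: subset_tuples_def D_set_def intro!: finite_PiE)

lemma of_int_tuple_sign: "of_int (tuple_sign s V) = tuple_sign s V"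
  by (simp add: tuple_sign_def)

text \<open>Distributivity is applied twice. In one copy of the product, \<open>X\<close> collects
  the k whose term -y^k is picked instead of 1; then the s copies are multiplied out, with one set
  per copy.\<close>

lemma prod_power_expansion:
  fixes y :: "'a :: comm_ring_1"
  shows "(\<Prod>k = 1..n. (1 - y ^ k) ^ s) =
           (\<Sum>V \<in> subset_tuples s n. tuple_sign s V * y ^ tuple_sum s V)"
proof -
  have "(\<Prod>k = 1..n. 1 - y ^ k) = (\<Prod>k = 1..n. (- (y ^ k)) + 1)"
    by simp
  also have "\<dots> = (\<Sum>X \<in> Pow {1..n}. \<Prod>k \<in> X. - (y ^ k))"
    by (subst prod_add) auto
  also have "\<dots> = (\<Sum>X \<in> Pow {1..n}. (-1) ^ card X * y ^ \<Sum>X)"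
    by (intro sum.cong refl) (simp add: prod_uminus power_sum)
  finally have *: "(\<Prod>k = 1..n. 1 - y ^ k) = (\<Sum>X \<in> Pow {1..n}. (-1) ^ card X * y ^ \<Sum>X)" .
  have "(\<Prod>k = 1..n. (1 - y ^ k) ^ s) = (\<Prod>i = 1..s. \<Prod>k = 1..n. 1 - y ^ k)"
    by (simp add: prod_power_distrib)
  also have "\<dots> = (\<Sum>V \<in> {1..s} \<rightarrow>\<^sub>E Pow {1..n}. \<Prod>i = 1..s. (-1) ^ card (V i) * y ^ \<Sum>(V i))"
    unfolding * by (rule prod_sum_PiE) auto
  finally show ?thesis
    by (simp add: subset_tuples_def D_set_def tuple_sign_def tuple_sum_def prod.distrib power_sum)
qed

section \<open>Degree bound, coefficients and the signed count\<close>

lemma tuple_sum_le: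
  assumes "V \<in> subset_tuples s n"
  shows "tuple_sum s V \<le> N_deg s n"
proof -
  have "(\<Sum>x \<in> V i. x) \<le> n * (n + 1) div 2" if "i \<in> {1..s}" for i
  proof -
    have "V i \<subseteq> {1..n}"
      using assms that by (auto simp: subset_tuples_def D_set_def PiE_def Pi_def)
    then have "(\<Sum>x \<in> V i. x) \<le> (\<Sum>x = 1..n. x)"
      by (intro sum_mono2) auto
    also have "\<dots> \<le> n * (n + 1) div 2"
      using gauss_sum_from_Suc_0[of n, where ?'a = nat] by simp
    finally show ?thesis .
  qed
  then have "tuple_sum s V \<le> (\<Sum>i = 1..s. n * (n + 1) div 2)"
    unfolding tuple_sum_def by (rule sum_mono)
  also have "\<dots> = N_deg s n"
    \<comment> \<open>The factor s may move inside the truncating \<open>div\<close> because n(n +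
      1) is even.\<close>
    using div_mult_swap[of 2 "n * (n + 1)" s]
    by (simp add: N_deg_def mult.assoc del: mult_Suc_right)
  finally show ?thesis .
qed

lemma coeff_T_poly:
  "coeff (T_poly s n) i =
     (\<Sum>V \<in> subset_tuples s n. if tuple_sum s V = i then tuple_sign s V else 0)"
proof -
  have "T_poly s n = (\<Prod>k = 1..n. (1 - monom 1 1 ^ k) ^ s)"
    by (simp add: T_poly_def monom_power)
  also have "\<dots> = (\<Sum>V \<in> subset_tuples s n. monom (tuple_sign s V) (tuple_sum s V))"
    unfolding prod_power_expansion
  proof (intro sum.cong refl)
    fix V
    \<comment> \<open>A power of -1 is a constant polynomial, so the sign can be absorbed into the
      coefficient of the monomial.\<close>
    have "(-1 :: int poly) ^ m = [:(-1) ^ m:]" for m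
      by (induction m) (auto simp: one_pCons)
    then show "tuple_sign s V * monom 1 1 ^ tuple_sum s V =
                 (monom (tuple_sign s V) (tuple_sum s V) :: int poly)"
      by (simp add: tuple_sign_def monom_power smult_monom)
  qed
  finally show ?thesis
    by (simp add: coeff_sum)
qed

text \<open>Tuples are grouped by their vector \<open>c V\<close> of cardinalities. The sign is
  constant on each group, so its sum over a group is that sign times \<open>M_count\<close>.\<close>

lemma M_signed_eq:
  "M_signed s n N j =
     (\<Sum>V | V \<in> subset_tuples s n \<and> [int (tuple_sum s V) = j] (mod int N). tuple_sign s V)"
proof -
  define A where "A = {V \<in> subset_tuples s n. [int (tuple_sum s V) = j] (mod int N)}"
  \<comment> \<open>Restricting to \<open>{1..s}\<close> makes \<open>c V\<close> extensional, so
    that it can equal an element of \<open>K\<close> as a function.\<close>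
  define c where "c V = (\<lambda>i \<in> {1..s}. card (V i))" for V :: "nat \<Rightarrow> nat set"
  define K where "K = {1..s} \<rightarrow>\<^sub>E {0..n}"
  have "finite A" and "finite K"
    by (auto simp: A_def K_def intro!: finite_PiE)
  have "c ` A \<subseteq> K"
  proof
    fix k assume "k \<in> c ` A"
    then obtain V where V: "V \<in> subset_tuples s n" and k: "k = c V"
      by (auto simp: A_def)
    have "card (V i) \<le> n" if "i \<in> {1..s}" for i
    proof -
      have "V i \<subseteq> {1..n}"
        using V that by (auto simp: subset_tuples_def D_set_def PiE_def Pi_def)
      then show ?thesis
        using card_mono[of "{1..n}" "V i"] by simp
    qed
    then show "k \<in> K"
      by (auto simp: K_def k c_def)
  qed
  have count: "M_count s n N k j = card {V \<in> A. c V = k}" if "k \<in> K" for k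
  proof -
    have "c V = k \<longleftrightarrow> (\<forall>i \<in> {1..s}. card (V i) = k i)" for V
      using that by (auto simp: c_def K_def fun_eq_iff PiE_def extensional_def)
    then show ?thesis
      by (auto simp: M_count_def A_def subset_tuples_def tuple_sum_def intro!: arg_cong[of _ _ card])
  qed
  have "M_signed s n N j = (\<Sum>k \<in> K. (-1) ^ (\<Sum>i = 1..s. k i) * int (M_count s n N k j))"
    by (simp add: M_signed_def K_def)
  also have "\<dots> = (\<Sum>k \<in> K. \<Sum>V | V \<in> A \<and> c V = k. tuple_sign s V)"
  proof (intro sum.cong refl)
    fix k assume "k \<in> K"
    have "(\<Sum>V | V \<in> A \<and> c V = k. tuple_sign s V) =
            (\<Sum>V | V \<in> A \<and> c V = k. (-1 :: int) ^ (\<Sum>i = 1..s. k i))"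
      by (intro sum.cong refl) (auto simp: tuple_sign_def c_def)
    then show "(-1) ^ (\<Sum>i = 1..s. k i) * int (M_count s n N k j) =
                 (\<Sum>V | V \<in> A \<and> c V = k. tuple_sign s V)"
      by (simp add: count[OF \<open>k \<in> K\<close>])
  qed
  also have "\<dots> = (\<Sum>V \<in> A. tuple_sign s V)"
    using \<open>finite A\<close> \<open>finite K\<close> \<open>c ` A \<subseteq> K\<close> by (rule sum.group)
  finally show ?thesis
    by (simp add: A_def)
qed

lemma M_signed_eq_sum_coeff:
  "M_signed s n N j =
     (\<Sum>i | i \<le> N_deg s n \<and> [int i = j] (mod int N). coeff (T_poly s n) i)"
proof -
  define I where "I = {i. i \<le> N_deg s n \<and> [int i = j] (mod int N)}"
  have "finite I"
    by (simp add: I_def)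
  have "(\<Sum>i \<in> I. coeff (T_poly s n) i) =
          (\<Sum>V \<in> subset_tuples s n. \<Sum>i \<in> I. if tuple_sum s V = i then tuple_sign s V else 0)"
    unfolding coeff_T_poly by (rule sum.swap)
  also have "\<dots> = (\<Sum>V \<in> subset_tuples s n. if tuple_sum s V \<in> I then tuple_sign s V else 0)"
    using \<open>finite I\<close> by simp
  also have "\<dots> = (\<Sum>V | V \<in> subset_tuples s n \<and> tuple_sum s V \<in> I. tuple_sign s V)"
    by (simp add: sum.If_cases Collect_conj_eq)
  \<comment> \<open>The bound in \<open>I\<close> excludes no tuple, since every total is at most
    \<open>N_deg s n\<close>.\<close>
  also have "\<dots> = M_signed s n N j"
    unfolding M_signed_eq by (intro sum.cong) (auto simp: I_def tuple_sum_le)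
  finally show ?thesis
    by (simp add: I_def)
qed

section \<open>Characters of Z_N as roots of unity, and orthogonality\<close>

definition root_char :: "nat \<Rightarrow> complex \<Rightarrow> int \<Rightarrow> complex" where
  "root_char N z = (\<lambda>x \<in> carrier (integer_mod_group N). z ^ nat x)"

lemma power_mod_root_of_unity:
  assumes "z ^ N = (1 :: 'a :: monoid_mult)"
  shows "z ^ (m mod N) = z ^ m"
proof -
  have "z ^ m = z ^ (N * (m div N) + m mod N)"
    by simp
  also have "\<dots> = z ^ (m mod N)"
    unfolding power_add power_mult using assms by simp
  finally show ?thesis ..
qed

lemma char_at_root_char:
  assumes "N \<ge> 1" and "z ^ N = 1"
  shows "char_at N (root_char N z) (int m) = z ^ m"
  using assms
  by (simp add: char_at_def root_char_def carrier_integer_mod_group power_mod_root_of_unity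
        flip: zmod_int)

lemma root_char_in_ZN_dual:
  assumes "N \<ge> 1" and z: "z ^ N = 1"
  shows "root_char N z \<in> ZN_dual N"
proof -
  have "z \<noteq> 0"
    using assms by (auto simp: power_0_left)
  moreover have "z ^ nat ((x + y) mod int N) = z ^ nat x * z ^ nat y" if "0 \<le> x" "0 \<le> y" for x y
    using that by (simp add: nat_mod_distrib nat_add_distrib power_mod_root_of_unity[OF z] power_add)
  ultimately show ?thesis
    using assms(1)
    by (auto simp: ZN_dual_def root_char_def hom_def complex_mult_group_def carrier_integer_mod_group)
qed

text \<open>A character is determined by its value z at the class of 1, and z^N = 1 because N copies
  of that class add up to 0, where the value is 1.\<close>

lemma ZN_dual_imp_root_char:
  assumes "N \<ge> 1" and "\<psi> \<in> ZN_dual N"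
  obtains z where "z ^ N = 1" and "\<psi> = root_char N z"
proof -
  \<comment> \<open>For N = 1 the integer 1 is not in the carrier, so the generator is 1 mod N.\<close>
  define z where "z = \<psi> (1 mod int N)"
  have nz: "\<psi> x \<noteq> 0" and mult: "y \<in> {0..<int N} \<Longrightarrow> \<psi> ((x + y) mod int N) = \<psi> x * \<psi> y"
    if "x \<in> {0..<int N}" for x y
    using that assms
    by (auto simp: ZN_dual_def hom_def complex_mult_group_def carrier_integer_mod_group Pi_def)
  have "\<psi> 0 = \<psi> 0 * \<psi> 0"
    using mult[of 0 0] assms(1) by simp
  with nz[of 0] assms(1) have \<psi>0: "\<psi> 0 = 1"
    by simp
  have pow: "\<psi> (int k mod int N) = z ^ k" for k
  proof (induction k)
    case (Suc k)
    have "int (Suc k) mod int N = (int k mod int N + 1 mod int N) mod int N"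
      by (simp add: mod_add_eq add.commute)
    then show ?case
      using mult[of "int k mod int N" "1 mod int N"] Suc assms(1) by (simp add: z_def)
  qed (simp add: \<psi>0)
  have "z ^ N = 1"
    using pow[of N] \<psi>0 by simp
  moreover have "\<psi> x = root_char N z x" for x
  proof (cases "x \<in> {0..<int N}")
    case True
    then show ?thesis
      using pow[of "nat x"] by (simp add: root_char_def carrier_integer_mod_group)
  next
    case False
    then show ?thesis
      using assms
      by (auto simp: ZN_dual_def root_char_def carrier_integer_mod_group extensional_def)
  qed
  ultimately show ?thesis
    using that by blast
qed

lemma bij_betw_root_char:
  assumes "N \<ge> 1"
  shows "bij_betw (root_char N) {z. z ^ N = 1} (ZN_dual N)"
proof (rule bij_betw_imageI)
  show "inj_on (root_char N) {z. z ^ N = 1}"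
  proof (rule inj_onI)
    fix y z assume "y \<in> {z. z ^ N = 1}" and "z \<in> {z. z ^ N = 1}"
      and "root_char N y = root_char N z"
    \<comment> \<open>Evaluation at the class of 1 recovers the root, also for N = 1, where that
      class is 0.\<close>
    then show "y = z"
      using char_at_root_char[OF assms, of y 1] char_at_root_char[OF assms, of z 1] by simp
  qed
  show "root_char N ` {z. z ^ N = 1} = ZN_dual N"
    using root_char_in_ZN_dual[OF assms] ZN_dual_imp_root_char[OF assms] by blast
qed

text \<open>With the roots listed as \<open>w k\<close>, the sum is a geometric series of ratio
  \<open>w m\<close>. Since the N-th power of this ratio is 1, the series vanishes unless the ratio
  itself is 1.\<close>

lemma sum_powers_roots_of_unity:
  assumes "N \<ge> 1"
  shows "(\<Sum>z | z ^ N = (1 :: complex). z ^ m) = (if N dvd m then of_nat N else 0)"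
proof -
  define w where "w = (\<lambda>k. cis (2 * pi * real k / real N))"
  have bij: "bij_betw w {..<N} {z. z ^ N = 1}"
    unfolding w_def using assms by (intro bij_betw_roots_unity) auto
  \<comment> \<open>This symmetry in k and m turns a sum of m-th powers over all roots into a
    geometric series.\<close>
  have w_power: "w k ^ m = w m ^ k" for k m
    by (simp add: w_def DeMoivre mult_ac)
  have root: "w 1 ^ N = 1"
    using assms by (simp add: w_def DeMoivre)
  have w_eq: "w m = w 1 ^ m" for m
    using w_power[of m 1] by simp
  have w_mod: "w m = w (m mod N)"
    by (metis w_eq power_mod_root_of_unity[OF root])
  have w0: "w 0 = 1"
    by (simp add: w_def)
  have "w m = 1 \<longleftrightarrow> N dvd m"
    unfolding dvd_eq_mod_eq_0
  proof
    assume "w m = 1"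
    \<comment> \<open>Injectivity of \<open>w\<close> is known only on \<open>{..<N}\<close>, hence
      the reduction of m modulo N.\<close>
    then have "w (m mod N) = w 0"
      using w_mod w0 by simp
    then show "m mod N = 0"
      using bij_betw_imp_inj_on[OF bij] assms by (auto dest: inj_onD)
  qed (use w_mod w0 in simp)
  moreover have "w m ^ N = 1"
    unfolding w_eq[of m] power_mult[symmetric] mult.commute[of m N] by (simp only: power_mult root power_one)
  moreover have "(\<Sum>z | z ^ N = 1. z ^ m) = (\<Sum>k<N. w m ^ k)"
    unfolding w_power[of m] by (rule sum.reindex_bij_betw[OF bij, symmetric])
  ultimately show ?thesis
    by (cases "N dvd m") (auto simp: geometric_sum)
qed

text \<open>On N-th roots of unity the inverse of z^k is z^(N - k), which reduces the claim to a
  power sum; k being at most N keeps the natural subtraction exact.\<close>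

lemma roots_of_unity_orthogonality:
  assumes "N \<ge> 1" and "k \<le> N"
  shows "(\<Sum>z | z ^ N = (1 :: complex). inverse (z ^ k) * z ^ m) =
           (if [m = k] (mod N) then of_nat N else 0)"
proof -
  have "(\<Sum>z | z ^ N = (1 :: complex). inverse (z ^ k) * z ^ m) =
          (\<Sum>z | z ^ N = 1. z ^ (m + (N - k)))"
  proof (intro sum.cong refl)
    fix z :: complex assume "z \<in> {z. z ^ N = 1}"
    then have "z ^ (N - k) * z ^ k = 1"
      using assms by (simp flip: power_add)
    then have "inverse (z ^ k) = z ^ (N - k)"
      by (metis inverse_unique mult.commute)
    then show "inverse (z ^ k) * z ^ m = z ^ (m + (N - k))"
      by (simp add: power_add)
  qed
  moreover have "N dvd m + (N - k) \<longleftrightarrow> [m = k] (mod N)"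
  proof -
    have "N dvd m + (N - k) \<longleftrightarrow> [m + (N - k) = 0] (mod N)"
      by (simp add: cong_0_iff)
    \<comment> \<open>Adding k undoes the subtraction: the left side becomes m + N.\<close>
    also have "\<dots> \<longleftrightarrow> [m + (N - k) + k = 0 + k] (mod N)"
      by (simp only: cong_add_rcancel_nat)
    also have "\<dots> \<longleftrightarrow> [m = k] (mod N)"
      using assms by (simp add: cong_def)
    finally show ?thesis .
  qed
  ultimately show ?thesis
    using sum_powers_roots_of_unity[OF assms(1)] by simp
qed

section \<open>The character formula\<close>

lemma trivial_char_eq: "trivial_char N = root_char N 1"
  by (simp add: trivial_char_def root_char_def)

lemma char_at_inverse_root_char:
  assumes "N \<ge> 1" and "z ^ N = 1"
  shows "char_at N (inverse_char N (root_char N z)) (int k) = inverse (z ^ k)"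
proof -
  have "char_at N (inverse_char N \<psi>) (int k) = inverse (char_at N \<psi> (int k))" for \<psi>
    using assms(1) by (simp add: char_at_def inverse_char_def carrier_integer_mod_group)
  then show ?thesis
    by (simp add: char_at_root_char[OF assms])
qed

text \<open>After expansion at each root and exchange of the two sums, every tuple carries an
  orthogonality sum, which selects the totals congruent to k.\<close>

lemma M_signed_eq_character_sum:
  assumes "s \<ge> 1" and "n \<ge> 1" and N: "N \<ge> 1" and "k \<le> N"
  shows "of_nat N * complex_of_int (M_signed s n N (int k)) =
           (\<Sum>\<psi> \<in> ZN_dual N - {trivial_char N}.
              char_at N (inverse_char N \<psi>) (int k) *
              (\<Prod>a \<in> D_set n. (1 - char_at N \<psi> (int a)) ^ s))"
    (is "_ = sum ?F _")
proof -
  have fin: "finite {z :: complex. z ^ N = 1}"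
    using N by (intro finite_roots_unity) auto
  have "finite (ZN_dual N)"
    using bij_betw_finite[OF bij_betw_root_char[OF N]] fin by simp
  have F: "?F (root_char N z) = inverse (z ^ k) * (\<Prod>a = 1..n. (1 - z ^ a) ^ s)" if "z ^ N = 1" for z
    using that N by (simp add: char_at_inverse_root_char char_at_root_char D_set_def)
  \<comment> \<open>At z = 1 every factor is 0^s: n >= 1 provides a factor, and s >= 1 makes it
    vanish.\<close>
  have "?F (trivial_char N) = 0"
    unfolding trivial_char_eq using assms by (subst F) (auto simp: power_0_left)
  then have "sum ?F (ZN_dual N - {trivial_char N}) = sum ?F (ZN_dual N)"
    using \<open>finite (ZN_dual N)\<close> by (intro sum.mono_neutral_left) auto
  also have "\<dots> = (\<Sum>z | z ^ N = 1. ?F (root_char N z))"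
    by (rule sum.reindex_bij_betw[OF bij_betw_root_char[OF N], symmetric])
  also have "\<dots> = (\<Sum>z | z ^ N = 1. inverse (z ^ k) * (\<Prod>a = 1..n. (1 - z ^ a) ^ s))"
    by (intro sum.cong refl F) simp
  also have "\<dots> = (\<Sum>z | z ^ N = 1. \<Sum>V \<in> subset_tuples s n.
                    tuple_sign s V * (inverse (z ^ k) * z ^ tuple_sum s V))"
    unfolding prod_power_expansion by (simp add: sum_distrib_left mult_ac)
  also have "\<dots> = (\<Sum>V \<in> subset_tuples s n. tuple_sign s V *
                    (\<Sum>z | z ^ N = 1. inverse (z ^ k) * z ^ tuple_sum s V))"
    unfolding sum_distrib_left by (rule sum.swap)
  also have "\<dots> = (\<Sum>V \<in> subset_tuples s n.
                    if [tuple_sum s V = k] (mod N) then of_nat N * tuple_sign s V else 0)"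
    unfolding roots_of_unity_orthogonality[OF N \<open>k \<le> N\<close>] by (intro sum.cong) auto
  also have "\<dots> = of_nat N * complex_of_int (M_signed s n N (int k))"
    by (auto simp: M_signed_eq of_int_tuple_sign sum_distrib_left cong_int_iff sum.inter_filter intro!: sum.cong)
  finally show ?thesis ..
qed

theorem theorem4p1:
  fixes s n N :: nat and j :: int
  assumes "s \<ge> 1" and "n \<ge> 1" and "N \<ge> 1"
    and "0 \<le> j" and "j < int N"
  shows "M_signed s n N j =
           (\<Sum>i | i \<le> N_deg s n \<and> [int i = j] (mod (int N)). coeff (T_poly s n) i) \<and>
         complex_of_int (M_signed s n N j) =
           1 / of_nat N *
           (\<Sum>\<psi> \<in> ZN_dual N - {trivial_char N}.
              char_at N (inverse_char N \<psi>) j *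
              (\<Prod>a \<in> D_set n. (1 - char_at N \<psi> (int a)) ^ s))"
proof (intro conjI)
  show "M_signed s n N j =
          (\<Sum>i | i \<le> N_deg s n \<and> [int i = j] (mod (int N)). coeff (T_poly s n) i)"
    by (rule M_signed_eq_sum_coeff)
next
  from assms obtain k where k: "j = int k" "k \<le> N"
    by (metis nonneg_int_cases of_nat_less_iff less_imp_le)
  show "complex_of_int (M_signed s n N j) =
          1 / of_nat N *
          (\<Sum>\<psi> \<in> ZN_dual N - {trivial_char N}.
             char_at N (inverse_char N \<psi>) j *
             (\<Prod>a \<in> D_set n. (1 - char_at N \<psi> (int a)) ^ s))"
    unfolding k(1) using assms k(2) by (simp flip: M_signed_eq_character_sum)
qed

end
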